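(* Suppose $G$ is a graph such that $\rho(G)=\omega(G)$ and $\chi_{\ell flex}(G) = k$. Then $\chi_{\ell flex}(K_1 \vee G) \leq k+1$. Consequently, if $G$ also satisfies $\chi_{\ell flex}(G) = \chi(G)$, then $\chi_{\ell flex}(K_1 \vee G) = \chi(K_1 \vee G)$.
   Context: All graphs are nonempty, finite, and simple. $\omega(G)$, $\alpha(G)$, $\chi(G)$ denote the clique number, independence number, and chromatic number. $G \vee H$ denotes the join of vertex-disjoint graphs $G$ and $H$ (every vertex of $G$ is made adjacent to every vertex of $H$). The Hall ratio of $G$ is $\rho(G)=\max_{\emptyset\neq H\subseteq G} |V(H)|/\alpha(H)$, the maximum being over all nonempty subgraphs $H$ of $G$. A list assignment $L$ for $G$ assigns to each vertex $v$ a set $L(v)$ of colors; it is a $k$-assignment if $|L(v)|=k$ for every $v \in V(G)$. A proper $L$-coloring of $G$ is a proper coloring $f$ with $f(v)\in L(v)$ for all $v \in V(G)$. A request of $L$ is a function $r$ with nonempty domain $D \subseteq V(G)$ such that $r(v)\in L(v)$ for each $v\in D$. For $\epsilon\in[0,1]$, the triple $(G,L,r)$ is $\epsilon$-satisfiable if there is a proper $L$-coloring $f$ of $G$ with $f(v)=r(v)$ for at least $\epsilon|D|$ vertices $v\in D$. The pair $(G,L)$ is $\epsilon$-flexible if $(G,L,r)$ is $\epsilon$-satisfiable for every request $r$ of $L$. $G$ is $(k,\epsilon)$-flexible if $(G,L)$ is $\epsilon$-flexible for every $k$-assignment $L$ for $G$. The list flexibility number $\chi_{\ell flex}(G)$ is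 the smallest $k$ such that $G$ is $(k,1/\rho(G))$-flexible. *)

theory Defs
  imports Complex_Main "Graph_Theory.Graph_Theory"
begin

(* A finite simple graph is a pair_graph: a finite, loop-free, symmetric arc relation.
   Each undirected edge uv is therefore represented by the two arcs (u, v) and (v, u). *)

definition is_clique :: "'a pair_pre_digraph \<Rightarrow> 'a set \<Rightarrow> bool" where
  "is_clique G S \<longleftrightarrow>
     S \<subseteq> pverts G \<and> (\<forall>u\<in>S. \<forall>v\<in>S. u \<noteq> v \<longrightarrow> (u, v) \<in> parcs G)"

definition is_independent :: "'a pair_pre_digraph \<Rightarrow> 'a set \<Rightarrow> bool" where
  "is_independent G S \<longleftrightarrow>
     S \<subseteq> pverts G \<and> (\<forall>u\<in>S. \<forall>v\<in>S. (u, v) \<notin> parcs G)"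

definition clique_number :: "'a pair_pre_digraph \<Rightarrow> nat" where
  "clique_number G = Max {card S | S. is_clique G S}"

definition independence_number :: "'a pair_pre_digraph \<Rightarrow> nat" where
  "independence_number G = Max {card S | S. is_independent G S}"

definition proper_coloring :: "'a pair_pre_digraph \<Rightarrow> ('a \<Rightarrow> nat) \<Rightarrow> bool" where
  "proper_coloring G f \<longleftrightarrow> (\<forall>(u, v)\<in>parcs G. f u \<noteq> f v)"

definition chromatic_number :: "'a pair_pre_digraph \<Rightarrow> nat" where
  "chromatic_number G = (LEAST n. \<exists>f. proper_coloring G f \<and> f ` pverts G \<subseteq> {..<n})"

(* Intended for vertex-disjoint G and H. *)
definition graph_join ::
    "'a pair_pre_digraph \<Rightarrow> 'a pair_pre_digraph \<Rightarrow> 'a pair_pre_digraph" where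
  "graph_join G H =
     \<lparr> pverts = pverts G \<union> pverts H,
       parcs = parcs G \<union> parcs H \<union> pverts G \<times> pverts H \<union> pverts H \<times> pverts G \<rparr>"

(* The library's subgraph relation is one of digraphs, so H is additionally required to be a
   graph, i.e. symmetric. *)
definition hall_ratio :: "'a pair_pre_digraph \<Rightarrow> real" where
  "hall_ratio G =
     Max {real (card (pverts H)) / real (independence_number H) | H.
            pair_graph H \<and> subgraph (with_proj H) (with_proj G) \<and> pverts H \<noteq> {}}"

(* Colors are natural numbers; since graphs and lists are finite, any infinite palette
   gives the same notions. Finiteness of the lists is explicit because infinite sets have
   cardinality 0. *)
definition k_assignment :: "'a pair_pre_digraph \<Rightarrow> nat \<Rightarrow> ('a \<Rightarrow> nat set) \<Rightarrow> bool" where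
  "k_assignment G k L \<longleftrightarrow> (\<forall>v\<in>pverts G. finite (L v) \<and> card (L v) = k)"

definition proper_list_coloring ::
    "'a pair_pre_digraph \<Rightarrow> ('a \<Rightarrow> nat set) \<Rightarrow> ('a \<Rightarrow> nat) \<Rightarrow> bool" where
  "proper_list_coloring G L f \<longleftrightarrow> proper_coloring G f \<and> (\<forall>v\<in>pverts G. f v \<in> L v)"

definition is_request ::
    "'a pair_pre_digraph \<Rightarrow> ('a \<Rightarrow> nat set) \<Rightarrow> ('a \<rightharpoonup> nat) \<Rightarrow> bool" where
  "is_request G L r \<longleftrightarrow>
     dom r \<noteq> {} \<and> dom r \<subseteq> pverts G \<and> (\<forall>v\<in>dom r. the (r v) \<in> L v)"

definition satisfiable ::
    "real \<Rightarrow> 'a pair_pre_digraph \<Rightarrow> ('a \<Rightarrow> nat set) \<Rightarrow> ('a \<rightharpoonup> nat) \<Rightarrow> bool" where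
  "satisfiable \<epsilon> G L r \<longleftrightarrow>
     (\<exists>f. proper_list_coloring G L f \<and>
          real (card {v \<in> dom r. f v = the (r v)}) \<ge> \<epsilon> * real (card (dom r)))"

definition flexible_pair :: "real \<Rightarrow> 'a pair_pre_digraph \<Rightarrow> ('a \<Rightarrow> nat set) \<Rightarrow> bool" where
  "flexible_pair \<epsilon> G L \<longleftrightarrow> (\<forall>r. is_request G L r \<longrightarrow> satisfiable \<epsilon> G L r)"

definition flexible :: "nat \<Rightarrow> real \<Rightarrow> 'a pair_pre_digraph \<Rightarrow> bool" where
  "flexible k \<epsilon> G \<longleftrightarrow> (\<forall>L. k_assignment G k L \<longrightarrow> flexible_pair \<epsilon> G L)"

(* k ranges over the positive integers: with empty lists there are no requests at all, so every
   nonempty graph is vacuously (0, \<epsilon>)-flexible. *)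
definition list_flexibility_number :: "'a pair_pre_digraph \<Rightarrow> nat" where
  "list_flexibility_number G = (LEAST k. k \<ge> 1 \<and> flexible k (1 / hall_ratio G) G)"

end

theory Submission
  imports Defs
begin

text \<open>
  Let \<open>J\<close> be the cone over \<open>G\<close> with apex \<open>x\<close>, and let \<open>w\<close> be the clique number of \<open>G\<close>. By
  hypothesis \<open>G\<close> is \<open>(k, 1/w)\<close>-flexible. A maximum clique of \<open>G\<close> together with \<open>x\<close> is a clique
  of \<open>J\<close>, so the Hall ratio of \<open>J\<close> is at least \<open>w + 1\<close> (\<open>hall_ratio_cone_ge\<close>), and it suffices
  to satisfy a fraction \<open>1/(w + 1)\<close> of every request on lists of size \<open>k + 1\<close>
  (\<open>flexible_cone\<close>).

  Once \<open>x\<close> has received a color \<open>c\<close>, delete \<open>c\<close> from the lists on \<open>G\<close>. At least \<open>k\<close> colors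
  remain at each vertex, and only the requests for \<open>c\<close> are lost. Flexibility of \<open>G\<close> then
  satisfies a fraction \<open>1/w\<close> of the others. The color \<open>c\<close> is found by averaging over a
  set \<open>S\<close> of exactly \<open>w + 1\<close> colors from the list of \<open>x\<close>, chosen to contain the color requested
  at \<open>x\<close>, if any. A request at a vertex of \<open>G\<close> is lost for at most one of the \<open>w + 1\<close> choices,
  hence survives at least \<open>w\<close> of them and contributes at least \<open>w \<cdot> (1/w) = 1\<close> in total; a
  request at \<open>x\<close> also contributes 1. Thus the guaranteed numbers of satisfied requests
  add up to at least \<open>|D|\<close> over the \<open>w + 1\<close> choices, and some choice achieves
  \<open>|D|/(w + 1)\<close>. The set \<open>S\<close> exists because \<open>w \<le> \<chi>(G) \<le> k\<close>: with
  identical lists of size \<open>k\<close>, flexibility yields a \<open>k\<close>-coloring.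
  Averaging over all \<open>k + 1\<close> colors would not do, since the request at \<open>x\<close> would be diluted
  too much when \<open>k > w\<close>.

  The consequence follows by squeezing, writing \<open>f(J)\<close> for the list flexibility number of \<open>J\<close>:
  \<open>\<chi>(G) + 1 \<le> \<chi>(J) \<le> f(J) \<le> k + 1 = \<chi>(G) + 1\<close>.

  The list flexibility number is a least element, so it has the properties it is named for only if
  some list size works at all. This is \<open>flexible_card_pverts\<close>: by definition of
  the Hall ratio, the domain of a request contains an independent set with the required
  fraction of its vertices; grant the requests there and color the rest greedily from lists
  as large as the vertex set.
\<close>

section \<open>Finite simple graphs and their joins\<close>

text \<open>
  The combinatorial content of the locale, in a form in which subgraphs and joins given by
  explicit records can be checked by set reasoning.
\<close>

lemma pair_graph_iff:
  "pair_graph G \<longleftrightarrow>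
     finite (pverts G) \<and> parcs G \<subseteq> pverts G \<times> pverts G \<and>
     (\<forall>v. (v, v) \<notin> parcs G) \<and> sym (parcs G)"
proof
  assume "pair_graph G"
  then interpret pair_graph G .
  show "finite (pverts G) \<and> parcs G \<subseteq> pverts G \<times> pverts G \<and>
     (\<forall>v. (v, v) \<notin> parcs G) \<and> sym (parcs G)"
    using sym_arcs no_loops wellformed' by (fastforce simp: symmetric_def)
next
  assume G: "finite (pverts G) \<and> parcs G \<subseteq> pverts G \<times> pverts G \<and>
     (\<forall>v. (v, v) \<notin> parcs G) \<and> sym (parcs G)"
  then have "finite (parcs G)"
    using finite_subset by blast
  with G show "pair_graph G"
    by unfold_locales (auto simp: symmetric_def)
qed

lemma subgraph_with_projI:
  assumes "pair_graph H" "pair_graph G" "pverts H \<subseteq> pverts G" "parcs H \<subseteq> parcs G"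
  shows "subgraph (with_proj H) (with_proj G)"
proof -
  interpret H: pair_graph H by fact
  interpret G: pair_graph G by fact
  show ?thesis
    using assms by (intro subgraphI) (auto simp: compatible_def H.wf_digraph G.wf_digraph)
qed

lemma complete_digraph_1E:
  assumes "complete_digraph 1 (with_proj K)"
  obtains x where "K = \<lparr>pverts = {x}, parcs = {}\<rparr>"
proof -
  obtain x where "pverts K = {x}"
    using assms card_1_singletonE unfolding complete_digraph_pair_def by metis
  moreover from this have "parcs K = {}"
    using assms unfolding complete_digraph_pair_def by auto
  ultimately show thesis
    by (intro that[of x]) simp
qed

lemma pverts_cone: "pverts (graph_join \<lparr>pverts = {x}, parcs = {}\<rparr> G) = insert x (pverts G)"
  and parcs_cone: "parcs (graph_join \<lparr>pverts = {x}, parcs = {}\<rparr> G) =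
    parcs G \<union> {x} \<times> pverts G \<union> pverts G \<times> {x}"
  by (auto simp: graph_join_def)

lemma pair_graph_cone:
  assumes "pair_graph G" "x \<notin> pverts G"
  shows "pair_graph (graph_join \<lparr>pverts = {x}, parcs = {}\<rparr> G)"
  using assms unfolding pair_graph_iff pverts_cone parcs_cone by (auto simp: sym_def)

section \<open>Cliques, independent sets and the Hall ratio\<close>

lemma finite_card_family:
  assumes "finite V" "\<And>S. P S \<Longrightarrow> S \<subseteq> V"
  shows "finite {card S | S. P S}"
proof (rule finite_subset)
  show "{card S | S. P S} \<subseteq> card ` Pow V"
    using assms(2) by auto
qed (use assms(1) in simp)

lemma maximum_cliqueE:
  assumes "finite (pverts G)"
  obtains S where "is_clique G S" "card S = clique_number G"
proof -
  have "finite {card S | S. is_clique G S}"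
    by (rule finite_card_family[OF assms]) (simp add: is_clique_def)
  moreover have "is_clique G {}"
    by (simp add: is_clique_def)
  then have "{card S | S. is_clique G S} \<noteq> {}"
    by blast
  ultimately have "clique_number G \<in> {card S | S. is_clique G S}"
    unfolding clique_number_def by (rule Max_in)
  then show thesis
    using that by auto
qed

lemma clique_number_pos:
  assumes "finite (pverts G)" "pverts G \<noteq> {}"
  shows "clique_number G \<ge> 1"
proof -
  obtain v where "v \<in> pverts G"
    using assms(2) by blast
  then have "is_clique G {v}"
    by (simp add: is_clique_def)
  then have "card {v} \<in> {card S | S. is_clique G S}"
    by blast
  moreover have "finite {card S | S. is_clique G S}"
    by (rule finite_card_family[OF assms(1)]) (simp add: is_clique_def)
  ultimately show ?thesis
    unfolding clique_number_def using Max_ge by fastforce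
qed

lemma maximum_independentE:
  assumes "finite (pverts G)"
  obtains S where "is_independent G S" "card S = independence_number G"
proof -
  have "finite {card S | S. is_independent G S}"
    by (rule finite_card_family[OF assms]) (simp add: is_independent_def)
  moreover have "is_independent G {}"
    by (simp add: is_independent_def)
  then have "{card S | S. is_independent G S} \<noteq> {}"
    by blast
  ultimately have "independence_number G \<in> {card S | S. is_independent G S}"
    unfolding independence_number_def by (rule Max_in)
  then show thesis
    using that by auto
qed

lemma card_le_independence_number:
  assumes "finite (pverts G)" "is_independent G S"
  shows "card S \<le> independence_number G"
  unfolding independence_number_def
proof (rule Max_ge)
  show "finite {card S | S. is_independent G S}"
    by (rule finite_card_family[OF assms(1)]) (simp add: is_independent_def)
qed (use assms(2) in blast)

lemma independence_number_pos:
  assumes "pair_graph G" "pverts G \<noteq> {}"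
  shows "independence_number G \<ge> 1"
proof -
  obtain v where "v \<in> pverts G"
    using assms(2) by blast
  then have "is_independent G {v}"
    using assms(1) by (auto simp: is_independent_def pair_graph_iff)
  then show ?thesis
    using card_le_independence_number[of G "{v}"] assms(1) by (simp add: pair_graph_iff)
qed

text \<open>
  The Hall ratio is a maximum over a set that must first be seen to be finite: a
  subgraph is determined by its pair of a vertex set and an arc set.
\<close>

lemma hall_ratio_ge:
  assumes G: "pair_graph G" and H: "pair_graph H" "pverts H \<noteq> {}"
    and sub: "pverts H \<subseteq> pverts G" "parcs H \<subseteq> parcs G"
  shows "real (card (pverts H)) / real (independence_number H) \<le> hall_ratio G"
  unfolding hall_ratio_def
proof (rule Max_ge)
  let ?\<H> = "{H. pair_graph H \<and> subgraph (with_proj H) (with_proj G) \<and> pverts H \<noteq> {}}"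
  have fin: "finite (pverts G)" "finite (parcs G)"
    using G finite_subset unfolding pair_graph_iff by blast+
  have "?\<H> \<subseteq> (\<lambda>(V, E). \<lparr>pverts = V, parcs = E\<rparr>) ` (Pow (pverts G) \<times> Pow (parcs G))"
  proof
    fix H assume "H \<in> ?\<H>"
    then have "(pverts H, parcs H) \<in> Pow (pverts G) \<times> Pow (parcs G)"
      by (auto simp: subgraph_def)
    then show "H \<in> (\<lambda>(V, E). \<lparr>pverts = V, parcs = E\<rparr>) ` (Pow (pverts G) \<times> Pow (parcs G))"
      by (intro rev_image_eqI) auto
  qed
  then have "finite ?\<H>"
    using fin by (rule_tac finite_subset) auto
  then have "finite ((\<lambda>H. real (card (pverts H)) / real (independence_number H)) ` ?\<H>)"
    by simp
  then show "finite {real (card (pverts H)) / real (independence_number H) | H. 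
      pair_graph H \<and> subgraph (with_proj H) (with_proj G) \<and> pverts H \<noteq> {}}"
    by (simp add: setcompr_eq_image)
  show "real (card (pverts H)) / real (independence_number H) \<in>
      {real (card (pverts H)) / real (independence_number H) | H.
        pair_graph H \<and> subgraph (with_proj H) (with_proj G) \<and> pverts H \<noteq> {}}"
    using H subgraph_with_projI[OF H(1) G sub] by blast
qed

text \<open>
  Passing to the induced subgraph only discards arcs that leave \<open>S\<close>, and these do not affect
  subsets of \<open>S\<close>.
\<close>

lemma is_independent_induced_iff:
  "is_independent \<lparr>pverts = S, parcs = E \<inter> S \<times> S\<rparr> I \<longleftrightarrow> I \<subseteq> S \<and> (\<forall>u\<in>I. \<forall>v\<in>I. (u, v) \<notin> E)"
  unfolding is_independent_def pair_pre_digraph.select_convs by blast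

text \<open>
  The subgraph induced by a clique has independence number 1.
\<close>

lemma hall_ratio_ge_card_clique:
  assumes G: "pair_graph G" and S: "is_clique G S" "S \<noteq> {}"
  shows "real (card S) \<le> hall_ratio G"
proof -
  let ?H = "\<lparr>pverts = S, parcs = parcs G \<inter> S \<times> S\<rparr>"
  have H: "pair_graph ?H"
    using G S finite_subset unfolding pair_graph_iff by (auto simp: is_clique_def sym_def)
  then have finH: "finite (pverts ?H)"
    by (simp only: pair_graph_iff)
  obtain I where I: "is_independent ?H I" "card I = independence_number ?H"
    by (rule maximum_independentE[OF finH])
  have IS: "I \<subseteq> S" and indep: "\<forall>u\<in>I. \<forall>v\<in>I. (u, v) \<notin> parcs G"
    using I(1) unfolding is_independent_induced_iff by blast+
  have "u = v" if "u \<in> I" "v \<in> I" for u v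
    using S(1) IS indep that unfolding is_clique_def by blast
  moreover have "finite I"
    using finite_subset[OF IS] finH by simp
  ultimately have "card I \<le> Suc 0"
    by (simp add: card_le_Suc0_iff_eq)
  moreover have "independence_number ?H \<ge> 1"
    using independence_number_pos[OF H] S(2) by simp
  ultimately have "independence_number ?H = 1"
    using I(2) by simp
  then show ?thesis
    using hall_ratio_ge[OF G H] S by (simp add: is_clique_def)
qed

lemma hall_ratio_cone_ge:
  assumes G: "pair_graph G" and x: "x \<notin> pverts G"
  shows "hall_ratio (graph_join \<lparr>pverts = {x}, parcs = {}\<rparr> G) \<ge> real (clique_number G + 1)"
proof -
  let ?J = "graph_join \<lparr>pverts = {x}, parcs = {}\<rparr> G"
  have fin: "finite (pverts G)"
    using G by (simp add: pair_graph_iff)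
  obtain S where S: "is_clique G S" "card S = clique_number G"
    by (rule maximum_cliqueE[OF fin])
  have SV: "S \<subseteq> pverts G"
    using S(1) by (simp add: is_clique_def)
  have "is_clique ?J (insert x S)"
    using S(1) SV unfolding is_clique_def pverts_cone parcs_cone by auto
  then have "real (card (insert x S)) \<le> hall_ratio ?J"
    by (intro hall_ratio_ge_card_clique pair_graph_cone G x) auto
  moreover have "card (insert x S) = clique_number G + 1"
    using S(2) SV x finite_subset[OF SV fin] by (subst card_insert_disjoint) auto
  ultimately show ?thesis
    by simp
qed

text \<open>
  Apply the bound in the Hall ratio to the subgraph induced by \<open>D\<close> and take
  a maximum independent set of it.
\<close>

lemma independent_subset_hall_ratio:
  assumes G: "pair_graph G" and D: "D \<subseteq> pverts G" "D \<noteq> {}"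
  obtains I where "is_independent G I" "I \<subseteq> D" "real (card I) \<ge> 1 / hall_ratio G * real (card D)"
proof -
  let ?H = "\<lparr>pverts = D, parcs = parcs G \<inter> D \<times> D\<rparr>"
  have H: "pair_graph ?H"
    using G D finite_subset unfolding pair_graph_iff by (auto simp: sym_def)
  then have finH: "finite (pverts ?H)"
    by (simp only: pair_graph_iff)
  obtain I where I: "is_independent ?H I" "card I = independence_number ?H"
    by (rule maximum_independentE[OF finH])
  have pos: "card I \<ge> 1" "card D > 0"
    using I(2) independence_number_pos[OF H] D(2) H by (auto simp: pair_graph_iff card_gt_0_iff)
  have le: "real (card D) / real (card I) \<le> hall_ratio G"
    using hall_ratio_ge[OF G H] D I(2) by auto
  moreover have "0 < real (card D) / real (card I)"
    using pos by simp
  ultimately have "hall_ratio G > 0"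
    by linarith
  then have "real (card I) \<ge> 1 / hall_ratio G * real (card D)"
    using le pos by (simp add: field_simps)
  moreover have "I \<subseteq> D" "is_independent G I"
    using I(1) D(1) unfolding is_independent_induced_iff by (auto simp only: is_independent_def)
  ultimately show thesis
    using that by blast
qed

section \<open>Colorings and flexibility\<close>

lemma chromatic_coloringE:
  assumes "pair_graph G"
  obtains f where "proper_coloring G f" "f ` pverts G \<subseteq> {..<chromatic_number G}"
proof -
  have fin: "finite (pverts G)"
    using assms by (simp add: pair_graph_iff)
  then obtain f :: "'a \<Rightarrow> nat" where f: "f ` pverts G = {0..<card (pverts G)}" "inj_on f (pverts G)"
    using ex_bij_betw_finite_nat unfolding bij_betw_def by blast
  have "f u \<noteq> f v" if "(u, v) \<in> parcs G" for u v
  proof -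
    have "u \<in> pverts G" "v \<in> pverts G" "u \<noteq> v"
      using assms that by (auto simp: pair_graph_iff)
    then show ?thesis
      using inj_onD[OF f(2)] by blast
  qed
  then have "proper_coloring G f"
    by (auto simp: proper_coloring_def)
  moreover have "f ` pverts G \<subseteq> {..<card (pverts G)}"
    using f(1) by auto
  ultimately have "\<exists>n f. proper_coloring G f \<and> f ` pverts G \<subseteq> {..<n}"
    by blast
  then have "\<exists>f. proper_coloring G f \<and> f ` pverts G \<subseteq> {..<chromatic_number G}"
    unfolding chromatic_number_def by (rule LeastI_ex)
  then show thesis
    using that by blast
qed

lemma chromatic_number_le:
  assumes "proper_coloring G f" "f ` pverts G \<subseteq> {..<n}"
  shows "chromatic_number G \<le> n"
  unfolding chromatic_number_def using assms by (intro Least_le) blast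

lemma clique_number_le_chromatic_number:
  assumes G: "pair_graph G"
  shows "clique_number G \<le> chromatic_number G"
proof -
  have fin: "finite (pverts G)"
    using G by (simp add: pair_graph_iff)
  obtain S where S: "is_clique G S" "card S = clique_number G"
    by (rule maximum_cliqueE[OF fin])
  obtain f where f: "proper_coloring G f" "f ` pverts G \<subseteq> {..<chromatic_number G}"
    by (rule chromatic_coloringE[OF G])
  have "inj_on f S"
    using S(1) f(1) by (fastforce simp: inj_on_def is_clique_def proper_coloring_def)
  moreover have "f ` S \<subseteq> {..<chromatic_number G}"
    using S(1) f(2) by (auto simp: is_clique_def)
  ultimately show ?thesis
    using card_inj_on_le[of f S "{..<chromatic_number G}"] S(2) by simp
qed

text \<open>
  The color of the apex is absent from \<open>G\<close>. Renaming the largest color to it frees the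
  largest color on \<open>G\<close>.
\<close>

lemma chromatic_number_cone_ge:
  assumes G: "pair_graph G" and x: "x \<notin> pverts G"
  shows "chromatic_number (graph_join \<lparr>pverts = {x}, parcs = {}\<rparr> G) \<ge> chromatic_number G + 1"
proof -
  let ?J = "graph_join \<lparr>pverts = {x}, parcs = {}\<rparr> G"
  define n where "n = chromatic_number ?J"
  obtain f where f: "proper_coloring ?J f" "f ` pverts ?J \<subseteq> {..<n}"
    using chromatic_coloringE[OF pair_graph_cone[OF G x]] unfolding n_def by blast
  define g where "g v = (if f v = n - 1 then f x else f v)" for v
  have fV: "f v < n" "f v \<noteq> f x" if "v \<in> pverts G" for v
    using f that unfolding pverts_cone parcs_cone proper_coloring_def by fastforce+
  have n: "f x < n"
    using f(2) by (auto simp: pverts_cone)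
  have "proper_coloring G g"
    unfolding proper_coloring_def
  proof (clarify)
    fix u v assume uv: "(u, v) \<in> parcs G" "g u = g v"
    then have "f u \<noteq> f v" "u \<in> pverts G" "v \<in> pverts G"
      using f(1) G by (auto simp: proper_coloring_def parcs_cone pair_graph_iff)
    then show False
      using uv(2) fV by (auto simp: g_def split: if_splits)
  qed
  moreover have "g ` pverts G \<subseteq> {..<n - 1}"
  proof
    fix c assume "c \<in> g ` pverts G"
    then obtain v where v: "v \<in> pverts G" "c = g v"
      by blast
    then show "c \<in> {..<n - 1}"
      using fV[OF v(1)] n by (auto simp: g_def)
  qed
  ultimately have "chromatic_number G \<le> n - 1"
    by (rule chromatic_number_le)
  then show ?thesis
    using n unfolding n_def by simp
qed

text \<open>
  Satisfying any request at all provides a list coloring; positive list size and a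
  vertex are what makes a request possible.
\<close>

lemma proper_list_coloring_if_flexible:
  assumes flex: "flexible k \<epsilon> G" and k: "k \<ge> 1" and G: "pverts G \<noteq> {}" and L: "k_assignment G k L"
  obtains f where "proper_list_coloring G L f"
proof -
  obtain v where v: "v \<in> pverts G"
    using G by blast
  then have "L v \<noteq> {}"
    using L k by (auto simp: k_assignment_def)
  then obtain c where "c \<in> L v"
    by blast
  then have "is_request G L [v \<mapsto> c]"
    using v by (simp add: is_request_def)
  then have "satisfiable \<epsilon> G L [v \<mapsto> c]"
    using flex L by (simp add: flexible_def flexible_pair_def)
  then show thesis
    using that by (auto simp: satisfiable_def)
qed

lemma chromatic_number_le_if_flexible:
  assumes flex: "flexible k \<epsilon> G" and k: "k \<ge> 1" and G: "pverts G \<noteq> {}"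
  shows "chromatic_number G \<le> k"
proof -
  have "k_assignment G k (\<lambda>_. {..<k})"
    by (simp add: k_assignment_def)
  then obtain f where "proper_list_coloring G (\<lambda>_. {..<k}) f"
    using proper_list_coloring_if_flexible[OF flex k G] by blast
  then show ?thesis
    by (intro chromatic_number_le[of G f]) (auto simp: proper_list_coloring_def)
qed

lemma satisfiable_mono:
  assumes "satisfiable \<epsilon> G L r" "\<delta> \<le> \<epsilon>"
  shows "satisfiable \<delta> G L r"
proof -
  have "\<delta> * real (card (dom r)) \<le> \<epsilon> * real (card (dom r))"
    using assms(2) by (simp add: mult_right_mono)
  then show ?thesis
    using assms(1) unfolding satisfiable_def by (meson order_trans)
qed

lemma flexible_mono:
  assumes "flexible k \<epsilon> G" "\<delta> \<le> \<epsilon>"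
  shows "flexible k \<delta> G"
  using assms satisfiable_mono unfolding flexible_def flexible_pair_def by blast

text \<open>
  When a vertex of \<open>B\<close> is colored, fewer than \<open>|I \<union> B|\<close> colors are in use, so its list contains
  an unused one.
\<close>

lemma greedy_extension:
  assumes B: "finite B" and I: "finite I" "I \<inter> B = {}"
    and sym: "sym E" and irrefl: "\<And>v. (v, v) \<notin> E"
    and f: "\<And>u v. u \<in> I \<Longrightarrow> v \<in> I \<Longrightarrow> (u, v) \<in> E \<Longrightarrow> f u \<noteq> f v"
    and L: "\<And>v. v \<in> B \<Longrightarrow> card (L v) \<ge> card (I \<union> B)"
  shows "\<exists>g. (\<forall>v\<in>I. g v = f v) \<and> (\<forall>v\<in>B. g v \<in> L v) \<and>
    (\<forall>u\<in>I \<union> B. \<forall>v\<in>I \<union> B. (u, v) \<in> E \<longrightarrow> g u \<noteq> g v)"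
  using B I(2) L
proof (induction B)
  case empty
  then show ?case
    using f by (intro exI[of _ f]) auto
next
  case (insert b B)
  have card: "card (I \<union> insert b B) = Suc (card (I \<union> B))"
    using insert.hyps insert.prems(1) I(1) by auto
  then have "\<exists>g. (\<forall>v\<in>I. g v = f v) \<and> (\<forall>v\<in>B. g v \<in> L v) \<and>
    (\<forall>u\<in>I \<union> B. \<forall>v\<in>I \<union> B. (u, v) \<in> E \<longrightarrow> g u \<noteq> g v)"
    using insert.prems by (intro insert.IH) fastforce+
  then obtain g where g: "\<forall>v\<in>I. g v = f v" "\<forall>v\<in>B. g v \<in> L v"
    "\<forall>u\<in>I \<union> B. \<forall>v\<in>I \<union> B. (u, v) \<in> E \<longrightarrow> g u \<noteq> g v"
    by blast
  have "card (g ` (I \<union> B)) \<le> card (I \<union> B)"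
    using insert.hyps I(1) by (intro card_image_le) simp
  also have "\<dots> < card (L b)"
    using insert.prems(2)[of b] card by simp
  finally have "\<not> L b \<subseteq> g ` (I \<union> B)"
    using insert.hyps I(1) card_mono[of "g ` (I \<union> B)" "L b"] by auto
  then obtain c where c: "c \<in> L b" "c \<notin> g ` (I \<union> B)"
    by blast
  have b: "b \<notin> I \<union> B"
    using insert.hyps insert.prems(1) by auto
  show ?case
  proof (intro exI[of _ "g(b := c)"] conjI ballI impI)
    fix u v assume uv: "u \<in> I \<union> insert b B" "v \<in> I \<union> insert b B" "(u, v) \<in> E"
    then have "u \<noteq> v"
      using irrefl by blast
    moreover have "(g(b := c)) w = g w" if "w \<in> I \<union> B" for w
      using b that by auto
    ultimately show "(g(b := c)) u \<noteq> (g(b := c)) v"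
      using uv g(3) c(2) b by (metis Un_insert_right fun_upd_same imageI insertE)
  qed (use g b c in auto)
qed

lemma flexible_card_pverts:
  assumes G: "pair_graph G"
  shows "flexible (card (pverts G)) (1 / hall_ratio G) G"
  unfolding flexible_def flexible_pair_def
proof (intro allI impI)
  fix L r assume L: "k_assignment G (card (pverts G)) L" and r: "is_request G L r"
  have fin: "finite (pverts G)"
    using G by (simp add: pair_graph_iff)
  have D: "dom r \<subseteq> pverts G" "dom r \<noteq> {}" "\<And>v. v \<in> dom r \<Longrightarrow> the (r v) \<in> L v"
    using r by (auto simp: is_request_def)
  obtain I where I: "is_independent G I" "I \<subseteq> dom r"
    "real (card I) \<ge> 1 / hall_ratio G * real (card (dom r))"
    by (rule independent_subset_hall_ratio[OF G D(1,2)])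
  have V: "I \<union> (pverts G - I) = pverts G"
    using I(2) D(1) by blast
  have "\<exists>g. (\<forall>v\<in>I. g v = the (r v)) \<and> (\<forall>v\<in>pverts G - I. g v \<in> L v) \<and>
    (\<forall>u\<in>I \<union> (pverts G - I). \<forall>v\<in>I \<union> (pverts G - I). (u, v) \<in> parcs G \<longrightarrow> g u \<noteq> g v)"
  proof (rule greedy_extension)
    show "card (I \<union> (pverts G - I)) \<le> card (L v)" if "v \<in> pverts G - I" for v
      using that L unfolding V by (simp add: k_assignment_def)
    show "finite I"
      using I(2) D(1) fin by (meson finite_subset)
    show "the (r u) \<noteq> the (r v)" if "u \<in> I" "v \<in> I" "(u, v) \<in> parcs G" for u v
      using that I(1) by (auto simp: is_independent_def)
  qed (use G fin in \<open>auto simp: pair_graph_iff\<close>)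
  then obtain g where g: "\<And>v. v \<in> I \<Longrightarrow> g v = the (r v)" "\<And>v. v \<in> pverts G - I \<Longrightarrow> g v \<in> L v"
    "\<And>u v. u \<in> pverts G \<Longrightarrow> v \<in> pverts G \<Longrightarrow> (u, v) \<in> parcs G \<Longrightarrow> g u \<noteq> g v"
    unfolding V by blast
  have "proper_list_coloring G L g"
    unfolding proper_list_coloring_def proper_coloring_def
  proof (intro conjI ballI)
    show "g v \<in> L v" if "v \<in> pverts G" for v
      using that g(1,2) D(3) subsetD[OF I(2)] by (cases "v \<in> I") simp_all
    show "case e of (u, v) \<Rightarrow> g u \<noteq> g v" if "e \<in> parcs G" for e
      using that G g(3) by (auto simp: pair_graph_iff)
  qed
  moreover have "card I \<le> card {v \<in> dom r. g v = the (r v)}"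
    using I(2) g(1) finite_subset[OF D(1) fin] by (intro card_mono) auto
  then have "1 / hall_ratio G * real (card (dom r)) \<le> real (card {v \<in> dom r. g v = the (r v)})"
    using I(3) by linarith
  ultimately show "satisfiable (1 / hall_ratio G) G L r"
    unfolding satisfiable_def by blast
qed

lemma flexible_list_flexibility_number:
  assumes "pair_graph G" "pverts G \<noteq> {}"
  shows "list_flexibility_number G \<ge> 1"
    and "flexible (list_flexibility_number G) (1 / hall_ratio G) G"
proof -
  have "card (pverts G) \<ge> 1"
    using assms by (simp add: pair_graph_iff Suc_leI card_gt_0_iff)
  then have "\<exists>k. k \<ge> 1 \<and> flexible k (1 / hall_ratio G) G"
    using flexible_card_pverts[OF assms(1)] by blast
  then have "list_flexibility_number G \<ge> 1 \<and>
      flexible (list_flexibility_number G) (1 / hall_ratio G) G"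
    unfolding list_flexibility_number_def by (rule LeastI_ex)
  then show "list_flexibility_number G \<ge> 1"
    "flexible (list_flexibility_number G) (1 / hall_ratio G) G"
    by auto
qed

lemma chromatic_number_le_list_flexibility_number:
  assumes "pair_graph G" "pverts G \<noteq> {}"
  shows "chromatic_number G \<le> list_flexibility_number G"
  using chromatic_number_le_if_flexible flexible_list_flexibility_number assms by blast

section \<open>Coloring the apex of a cone\<close>

text \<open>
  Deleting the apex color \<open>c\<close> from the lists on \<open>G\<close> costs exactly the requests for \<open>c\<close>.
  At least \<open>k\<close> colors remain in each list, which is cut down to exactly \<open>k\<close> colors, keeping the requested ones, so that
  the flexibility of \<open>G\<close> applies to the surviving requests. Here \<open>D\<close> may be empty,
  and the bound is multiplied by \<open>w\<close> to stay within the natural numbers.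
\<close>

lemma cone_coloring_with_apex_color:
  assumes G: "pair_graph G" "pverts G \<noteq> {}" and x: "x \<notin> pverts G"
    and flex: "flexible k (1 / real w) G" and k: "k \<ge> 1" and w: "w \<ge> 1"
    and L: "k_assignment G (k + 1) L" and c: "c \<in> L x"
    and D: "D \<subseteq> pverts G" and r: "\<And>v. v \<in> D \<Longrightarrow> r v \<in> L v"
  obtains f where "proper_list_coloring (graph_join \<lparr>pverts = {x}, parcs = {}\<rparr> G) L f" "f x = c"
    "w * card {v \<in> D. f v = r v} \<ge> card {v \<in> D. r v \<noteq> c}"
proof -
  \<comment> \<open>The vertices whose requests survive the deletion of \<open>c\<close>.\<close>
  define A where "A = {v \<in> D. r v \<noteq> c}"
  have "\<exists>M. M \<subseteq> L v - {c} \<and> finite M \<and> card M = k \<and> (v \<in> A \<longrightarrow> r v \<in> M)" if v: "v \<in> pverts G" for v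
  proof -
    define R where "R = (if v \<in> A then {r v} else {})"
    have Lv: "finite (L v)" "card (L v) = k + 1"
      using L v by (auto simp: k_assignment_def)
    have "R \<subseteq> L v - {c}"
      using r by (auto simp: R_def A_def)
    moreover have "card R \<le> k"
      using k by (simp add: R_def)
    moreover have "k \<le> card (L v - {c})"
      using Lv by (simp add: card_Diff_singleton_if)
    ultimately obtain M where "R \<subseteq> M" "M \<subseteq> L v - {c}" "card M = k"
      using exists_subset_between[of R k "L v - {c}"] Lv(1) by auto
    then show ?thesis
      using Lv(1) finite_subset[of M "L v - {c}"] by (intro exI[of _ M]) (auto simp: R_def)
  qed
  then obtain M where M: "\<And>v. v \<in> pverts G \<Longrightarrow> M v \<subseteq> L v - {c}"
    "\<And>v. v \<in> pverts G \<Longrightarrow> finite (M v) \<and> card (M v) = k"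
    "\<And>v. v \<in> pverts G \<Longrightarrow> v \<in> A \<Longrightarrow> r v \<in> M v"
    by metis
  have AV: "A \<subseteq> pverts G"
    using D by (auto simp: A_def)
  have assign: "k_assignment G k M"
    using M(2) by (simp add: k_assignment_def)
  obtain g where g: "proper_list_coloring G M g" "card A \<le> w * card {v \<in> A. g v = r v}"
  proof (cases "A = {}")
    \<comment> \<open>Requests have nonempty domain, so without survivors any list coloring is taken.\<close>
    case True
    obtain g where "proper_list_coloring G M g"
      by (rule proper_list_coloring_if_flexible[OF flex k G(2) assign])
    then show thesis
      using that True by simp
  next
    case False
    define q where "q v = (if v \<in> A then Some (r v) else None)" for v
    have dom: "dom q = A"
      by (auto simp: q_def dom_def)
    have "is_request G M q"
      using False AV M(3) unfolding is_request_def dom by (auto simp: q_def)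
    then have "satisfiable (1 / real w) G M q"
      using flex assign by (simp add: flexible_def flexible_pair_def)
    then obtain g where g: "proper_list_coloring G M g"
      "real (card {v \<in> A. g v = the (q v)}) \<ge> 1 / real w * real (card A)"
      unfolding satisfiable_def dom by blast
    have "{v \<in> A. g v = the (q v)} = {v \<in> A. g v = r v}"
      by (auto simp: q_def)
    then have "real (card A) \<le> real (w * card {v \<in> A. g v = r v})"
      using g(2) w by (simp add: field_simps)
    then show thesis
      using that g(1) of_nat_le_iff by blast
  qed
  have gM: "g v \<in> L v" "g v \<noteq> c" if "v \<in> pverts G" for v
    using g(1) M(1)[OF that] that by (auto simp: proper_list_coloring_def)
  have "(g(x := c)) u \<noteq> (g(x := c)) v"
    if "(u, v) \<in> parcs G \<union> {x} \<times> pverts G \<union> pverts G \<times> {x}" for u v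
  proof -
    have "g u \<noteq> g v" "u \<in> pverts G" "v \<in> pverts G" if "(u, v) \<in> parcs G"
      using g(1) G(1) that by (auto simp: proper_list_coloring_def proper_coloring_def pair_graph_iff)
    then show ?thesis
      using that gM(2) x by auto
  qed
  then have "proper_coloring (graph_join \<lparr>pverts = {x}, parcs = {}\<rparr> G) (g(x := c))"
    unfolding proper_coloring_def parcs_cone by blast
  then have "proper_list_coloring (graph_join \<lparr>pverts = {x}, parcs = {}\<rparr> G) L (g(x := c))"
    using gM(1) c by (simp add: proper_list_coloring_def pverts_cone)
  moreover have "card {v \<in> A. g v = r v} \<le> card {v \<in> D. (g(x := c)) v = r v}"
  proof (rule card_mono)
    show "finite {v \<in> D. (g(x := c)) v = r v}"
      using finite_subset[OF D] G(1) by (simp add: pair_graph_iff)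
    show "{v \<in> A. g v = r v} \<subseteq> {v \<in> D. (g(x := c)) v = r v}"
      using D x by (auto simp: A_def)
  qed
  then have "w * card {v \<in> D. (g(x := c)) v = r v} \<ge> card {v \<in> D. r v \<noteq> c}"
    using g(2) unfolding A_def by (meson le_trans mult_le_mono2)
  ultimately show thesis
    by (intro that[of "g(x := c)"]) simp_all
qed

text \<open>
  Double counting: every \<open>v \<in> D\<close> is counted for all but at most one of the \<open>w + 1\<close> colors.
\<close>

lemma sum_card_avoiding_ge:
  assumes S: "finite S" "card S = w + 1" and D: "finite D"
  shows "(\<Sum>c\<in>S. card {v \<in> D. r v \<noteq> c}) \<ge> w * card D"
proof -
  have "(\<Sum>c\<in>S. card {v \<in> D. r v \<noteq> c}) = (\<Sum>c\<in>S. \<Sum>v\<in>D. if r v \<noteq> c then 1 else 0)"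
    using D by (simp add: sum.If_cases Int_def)
  also have "\<dots> = (\<Sum>v\<in>D. \<Sum>c\<in>S. if r v \<noteq> c then 1 else 0)"
    by (rule sum.swap)
  also have "\<dots> = (\<Sum>v\<in>D. card (S - {r v}))"
  proof (rule sum.cong[OF refl])
    fix v assume "v \<in> D"
    have "S \<inter> {c. r v \<noteq> c} = S - {r v}"
      by auto
    then show "(\<Sum>c\<in>S. if r v \<noteq> c then 1 else 0) = card (S - {r v})"
      using S(1) by (simp add: sum.If_cases)
  qed
  also have "\<dots> \<ge> (\<Sum>v\<in>D. w)"
    using S by (intro sum_mono) (simp add: card_Diff_singleton_if)
  finally show ?thesis
    by (simp add: mult.commute)
qed

text \<open>
  The averaging argument that selects the apex color. The condition \<open>w \<le> k\<close> makes room for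
  \<open>w + 1\<close> candidate colors at the apex.
\<close>

lemma flexible_cone:
  assumes G: "pair_graph G" "pverts G \<noteq> {}" and x: "x \<notin> pverts G"
    and flex: "flexible k (1 / real w) G" and w: "1 \<le> w" "w \<le> k"
  shows "flexible (k + 1) (1 / real (w + 1)) (graph_join \<lparr>pverts = {x}, parcs = {}\<rparr> G)"
  unfolding flexible_def flexible_pair_def
proof (intro allI impI)
  let ?J = "graph_join \<lparr>pverts = {x}, parcs = {}\<rparr> G"
  fix L r assume L: "k_assignment ?J (k + 1) L" and r: "is_request ?J L r"
  define D where "D = dom r - {x}"
  define R where "R = (if x \<in> dom r then {the (r x)} else {})"
  have dom: "dom r \<subseteq> insert x (pverts G)" "\<And>v. v \<in> dom r \<Longrightarrow> the (r v) \<in> L v"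
    using r by (auto simp: is_request_def pverts_cone)
  have Lx: "finite (L x)" "card (L x) = k + 1" and LG: "k_assignment G (k + 1) L"
    using L by (auto simp: k_assignment_def pverts_cone)
  have DV: "D \<subseteq> pverts G" and rD: "\<And>v. v \<in> D \<Longrightarrow> the (r v) \<in> L v"
    using dom by (auto simp: D_def)
  have fin: "finite (dom r)" "finite D"
    using G(1) dom(1) finite_subset unfolding pair_graph_iff D_def by blast+
  have "R \<subseteq> L x" "card R \<le> w + 1" "w + 1 \<le> card (L x)"
    using dom(2) Lx w by (auto simp: R_def)
  then obtain S where S: "R \<subseteq> S" "S \<subseteq> L x" "card S = w + 1"
    using exists_subset_between[of R "w + 1" "L x"] Lx(1) by auto
  have finS: "finite S"
    using S(2) Lx(1) by (rule finite_subset)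
  \<comment> \<open>\<open>w\<close> times the guaranteed number of satisfied requests if the apex gets color \<open>c\<close>;
    \<open>R \<inter> {c}\<close> is nonempty exactly if this grants the request at the apex.\<close>
  define score where "score c = w * card (R \<inter> {c}) + card {v \<in> D. the (r v) \<noteq> c}" for c
  have card_dom: "card (dom r) = card R + card D"
    using fin by (simp add: R_def D_def card_Suc_Diff1 del: card_Diff_insert)
  have "(\<Sum>c\<in>S. card (R \<inter> {c})) = card R"
  proof (cases "x \<in> dom r")
    case True
    then have "(\<Sum>c\<in>S. card (R \<inter> {c})) = (\<Sum>c\<in>S. if the (r x) = c then 1 else 0)"
      by (intro sum.cong) (auto simp: R_def)
    then show ?thesis
      using S(1) finS True by (simp add: R_def)
  qed (simp add: R_def)
  then have total: "w * card (dom r) \<le> sum score S"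
    using sum_card_avoiding_ge[OF finS S(3) fin(2), of "\<lambda>v. the (r v)"]
    unfolding score_def card_dom by (simp add: sum.distrib sum_distrib_left[symmetric] algebra_simps)
  have "\<exists>c\<in>S. w * card (dom r) \<le> (w + 1) * score c"
  proof (rule ccontr)
    assume "\<not> ?thesis"
    then have "(\<Sum>c\<in>S. (w + 1) * score c) < (\<Sum>c\<in>S. w * card (dom r))"
      using S(3) finS by (intro sum_strict_mono) auto
    also have "\<dots> = (w + 1) * (w * card (dom r))"
      using S(3) by simp
    also have "\<dots> \<le> (w + 1) * sum score S"
      using total by (rule mult_le_mono2)
    finally show False
      by (simp only: sum_distrib_left[symmetric])
  qed
  then obtain c where c: "c \<in> S" "w * card (dom r) \<le> (w + 1) * score c"
    by blast
  obtain f where f: "proper_list_coloring ?J L f" "f x = c"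
    "w * card {v \<in> D. f v = the (r v)} \<ge> card {v \<in> D. the (r v) \<noteq> c}"
    using cone_coloring_with_apex_color[OF G x flex _ w(1) LG _ DV rD] c(1) S(2) w by force
  let ?sat = "{v \<in> dom r. f v = the (r v)}"
  \<comment> \<open>\<open>?X\<close> is the contribution of the apex to the satisfied requests.\<close>
  let ?X = "if R \<inter> {c} = {} then {} else {x}"
  have "?sat = ?X \<union> {v \<in> D. f v = the (r v)}"
    using f(2) by (auto simp: D_def R_def split: if_splits)
  also have "card \<dots> = card ?X + card {v \<in> D. f v = the (r v)}"
    using fin by (intro card_Un_disjoint) (auto simp: D_def)
  also have "card ?X = card (R \<inter> {c})"
    by (simp add: R_def)
  finally have "score c \<le> w * card ?sat"
    using f(3) unfolding score_def by (simp add: algebra_simps)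
  then have "(w + 1) * score c \<le> (w + 1) * (w * card ?sat)"
    by (rule mult_le_mono2)
  with c(2) have "w * card (dom r) \<le> w * ((w + 1) * card ?sat)"
    by (simp only: mult.left_commute[of "w + 1" w])
  then have "card (dom r) \<le> (w + 1) * card ?sat"
    using w(1) by simp
  then have "real (card (dom r)) \<le> real (w + 1) * real (card ?sat)"
    by (metis of_nat_le_iff of_nat_mult)
  then have "real (card ?sat) \<ge> 1 / real (w + 1) * real (card (dom r))"
    by (simp add: field_simps)
  then show "satisfiable (1 / real (w + 1)) ?J L r"
    unfolding satisfiable_def using f(1) by blast
qed

section \<open>List flexibility of a cone\<close>

theorem theorem7:
  fixes G K :: "'a pair_pre_digraph" and k :: nat
  assumes "pair_graph G" and "pverts G \<noteq> {}"
    and "hall_ratio G = real (clique_number G)"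
    and "list_flexibility_number G = k"
    and "complete_digraph 1 (with_proj K)" and "pverts K \<inter> pverts G = {}"
  shows "list_flexibility_number (graph_join K G) \<le> k + 1 \<and>
    (list_flexibility_number G = chromatic_number G \<longrightarrow>
       list_flexibility_number (graph_join K G) = chromatic_number (graph_join K G))"
proof -
  obtain x where K: "K = \<lparr>pverts = {x}, parcs = {}\<rparr>"
    by (rule complete_digraph_1E[OF assms(5)])
  have x: "x \<notin> pverts G"
    using assms(6) K by simp
  define w where "w = clique_number G"
  let ?J = "graph_join K G"
  have J: "pair_graph ?J" "pverts ?J \<noteq> {}"
    using pair_graph_cone[OF assms(1) x] by (auto simp: K pverts_cone)
  have w: "1 \<le> w" "w \<le> k"
    using clique_number_pos[of G] clique_number_le_chromatic_number[OF assms(1)]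
      chromatic_number_le_list_flexibility_number[OF assms(1,2)] assms(1,2,4)
    unfolding w_def pair_graph_iff by simp_all
  have "flexible k (1 / real w) G"
    using flexible_list_flexibility_number(2)[OF assms(1,2)] assms(3,4) by (simp add: w_def)
  then have "flexible (k + 1) (1 / real (w + 1)) ?J"
    unfolding K by (rule flexible_cone[OF assms(1,2) x _ w])
  moreover have "1 / hall_ratio ?J \<le> 1 / real (w + 1)"
    using hall_ratio_cone_ge[OF assms(1) x] unfolding K w_def by (intro divide_left_mono) auto
  ultimately have "flexible (k + 1) (1 / hall_ratio ?J) ?J"
    by (rule flexible_mono)
  then have upper: "list_flexibility_number ?J \<le> k + 1"
    unfolding list_flexibility_number_def by (intro Least_le) simp
  have "list_flexibility_number ?J = chromatic_number ?J"
    if "list_flexibility_number G = chromatic_number G"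
  proof (rule antisym)
    have "k + 1 \<le> chromatic_number ?J"
      using chromatic_number_cone_ge[OF assms(1) x] that assms(4) K by simp
    then show "list_flexibility_number ?J \<le> chromatic_number ?J"
      using upper by simp
    show "chromatic_number ?J \<le> list_flexibility_number ?J"
      by (rule chromatic_number_le_list_flexibility_number[OF J])
  qed
  with upper show ?thesis
    by blast
qed

end
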